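(* Let $\eta$ be a positive random variable (i.e. $P(\eta>0)=1$) with distribution function $F(x)=P(\eta\le x)$. If $F$ is slowly varying at zero, then $F$ is not selfdecomposable.
   Context: A function $L$, positive and measurable on some interval $(0,\delta)$, is slowly varying at $0$ if $\lim_{s\to0+}L(cs)/L(s)=1$ for each $c>0$. A random variable $\eta$ (or its distribution, or its distribution function) is selfdecomposable if for every $0<c<1$ there is a random variable $\eta_c$, independent of $\eta$, such that $\eta\overset{d}{=}c\,\eta+\eta_c$. *)

theory Defs
  imports "HOL-Probability.Probability"
begin

definition slowly_varying_at_0 :: "(real \<Rightarrow> real) \<Rightarrow> bool" where
  "slowly_varying_at_0 L \<longleftrightarrow>
     (\<exists>\<delta>>0. (\<forall>s\<in>{0<..<\<delta>}. L s > 0) \<and> L \<in> borel_measurable (lebesgue_on {0<..<\<delta>})) \<and>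
     (\<forall>c>0. ((\<lambda>s. L (c * s) / L s) \<longlongrightarrow> 1) (at_right 0))"

text \<open>
  Selfdecomposability is a property of the law \<open>\<mu>\<close> alone, and the random variable \<open>\<eta>\<^sub>c\<close> may
  live on an enlarged probability space. Hence the definition asks for some probability space
  carrying a copy \<open>X\<close> of \<open>\<eta>\<close> together with \<open>Y = \<eta>\<^sub>c\<close> independent of \<open>X\<close>. HOL cannot quantify
  over the type of the sample points; \<open>selfdecomposable_lawI\<close> shows that fixing it to
  \<open>real \<times> real\<close> loses nothing.
\<close>
definition selfdecomposable_law :: "real measure \<Rightarrow> bool" where
  "selfdecomposable_law \<mu> \<longleftrightarrow>
     (\<forall>c. 0 < c \<and> c < 1 \<longrightarrow>
       (\<exists>(N :: (real \<times> real) measure) X Y.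
          prob_space N \<and> prob_space.indep_var N borel X borel Y \<and>
          distr N borel X = \<mu> \<and> distr N borel (\<lambda>\<omega>. c * X \<omega> + Y \<omega>) = \<mu>))"

lemma selfdecomposable_lawI:
  fixes \<mu> :: "real measure" and N :: "real \<Rightarrow> 'b measure" and X Y :: "real \<Rightarrow> 'b \<Rightarrow> real"
  assumes "\<And>c. 0 < c \<Longrightarrow> c < 1 \<Longrightarrow>
             prob_space (N c) \<and> prob_space.indep_var (N c) borel (X c) borel (Y c) \<and>
             distr (N c) borel (X c) = \<mu> \<and>
             distr (N c) borel (\<lambda>\<omega>. c * X c \<omega> + Y c \<omega>) = \<mu>"
  shows "selfdecomposable_law \<mu>"
  unfolding selfdecomposable_law_def
proof (intro allI impI)
  fix c :: real
  assume "0 < c \<and> c < 1"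
  with assms[of c] have N: "prob_space (N c)"
    and ind: "prob_space.indep_var (N c) borel (X c) borel (Y c)"
    and dX: "distr (N c) borel (X c) = \<mu>"
    and dS: "distr (N c) borel (\<lambda>\<omega>. c * X c \<omega> + Y c \<omega>) = \<mu>" by auto
  interpret N: prob_space "N c" by (rule N)
  have mX [measurable]: "X c \<in> borel_measurable (N c)"
    and mY [measurable]: "Y c \<in> borel_measurable (N c)"
    using N.indep_var_rv1[OF ind] N.indep_var_rv2[OF ind] by auto
  define P where "P = distr (N c) (borel \<Otimes>\<^sub>M borel) (\<lambda>\<omega>. (X c \<omega>, Y c \<omega>))"
  have sets_P [measurable_cong]: "sets P = sets (borel \<Otimes>\<^sub>M borel)" by (simp add: P_def)
  interpret P: prob_space P unfolding P_def by (rule N.prob_space_distr) measurable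
  have d1: "distr P borel fst = distr (N c) borel (X c)"
    unfolding P_def by (subst distr_distr) (auto simp: comp_def)
  have d2: "distr P borel snd = distr (N c) borel (Y c)"
    unfolding P_def by (subst distr_distr) (auto simp: comp_def)
  have d3: "distr P borel (\<lambda>\<omega>. c * fst \<omega> + snd \<omega>) = distr (N c) borel (\<lambda>\<omega>. c * X c \<omega> + Y c \<omega>)"
    unfolding P_def by (subst distr_distr) (auto simp: comp_def)
  have "distr P (borel \<Otimes>\<^sub>M borel) (\<lambda>\<omega>. (fst \<omega>, snd \<omega>)) = P"
    using distr_id2[OF sets_P[symmetric]] by simp
  then have "P.indep_var borel fst borel snd"
    using ind unfolding P.indep_var_distribution_eq N.indep_var_distribution_eq d1 d2
    by (simp add: P_def)
  with d1 d3 dX dS P.prob_space_axioms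
  show "\<exists>(N :: (real \<times> real) measure) X Y.
          prob_space N \<and> prob_space.indep_var N borel X borel Y \<and>
          distr N borel X = \<mu> \<and> distr N borel (\<lambda>\<omega>. c * X \<omega> + Y \<omega>) = \<mu>"
    by (intro exI[of _ P] exI[of _ fst] exI[of _ snd]) simp
qed

definition selfdecomposable :: "(real \<Rightarrow> real) \<Rightarrow> bool" where
  "selfdecomposable F \<longleftrightarrow> (\<exists>\<mu>. real_distribution \<mu> \<and> cdf \<mu> = F \<and> selfdecomposable_law \<mu>)"

text \<open>A distribution function determines its law, so the choice of \<open>\<mu>\<close> above is immaterial.\<close>
lemma selfdecomposable_cdf_iff:
  assumes "real_distribution \<mu>"
  shows "selfdecomposable (cdf \<mu>) \<longleftrightarrow> selfdecomposable_law \<mu>"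
  using assms cdf_unique unfolding selfdecomposable_def by blast

end

theory Submission
  imports Defs
begin

text \<open>
  Suppose that \<open>X\<close> has the law of \<open>\<eta>\<close> and that \<open>c * X + Y\<close>, with \<open>Y\<close> independent of \<open>X\<close>, has
  this law again. A slowly varying \<open>F\<close> is positive near zero, so \<open>X\<close> comes arbitrarily close to
  zero with positive probability, and a negative value of \<open>Y\<close> could not always be compensated
  by \<open>c * X\<close>; hence \<open>Y \<ge> 0\<close> almost surely (\<open>AE_nonneg_of_indep_sum\<close>). A sum of nonnegative terms
  is at most \<open>s\<close> only if both are, so \<open>F s \<le> F (s / c) * P(Y \<le> s)\<close>
  (\<open>prob_indep_sum_le\<close>). Slow variation says that \<open>F s / F (s / c)\<close> tends to \<open>1\<close>, which
  forces \<open>P(Y \<le> s)\<close> to tend to \<open>1\<close> as \<open>s\<close> decreases to zero: all the mass of \<open>Y\<close> sits at zero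
  (\<open>prob_remainder_nonpos\<close>).

  So slow variation makes the decomposition degenerate: \<open>X\<close> and \<open>c * X\<close> have the same
  law. Rescaling repeatedly gives \<open>F s \<ge> F (s / c ^ n)\<close>, which tends to \<open>1\<close>. Thus \<open>F s = 1\<close> for
  every \<open>s > 0\<close>, and right continuity gives \<open>F 0 = 1\<close>, whereas \<open>F 0 = 0\<close> by positivity.
\<close>

lemma cdf_distr_eq_prob:
  fixes X :: "'b \<Rightarrow> real"
  assumes "X \<in> borel_measurable N"
  shows "cdf (distr N borel X) x = measure N {\<omega> \<in> space N. X \<omega> \<le> x}"
  using assms by (auto simp: cdf_def measure_distr intro!: arg_cong[where f = "measure N"])

lemma (in prob_space) prob_indep_conj:
  fixes X Y :: "'a \<Rightarrow> real"
  assumes ind: "indep_var borel X borel Y"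
    and [measurable]: "A \<in> sets borel" "B \<in> sets borel"
  shows "prob {\<omega> \<in> space M. X \<omega> \<in> A \<and> Y \<omega> \<in> B} =
         prob {\<omega> \<in> space M. X \<omega> \<in> A} * prob {\<omega> \<in> space M. Y \<omega> \<in> B}"
proof -
  have "{\<omega> \<in> space M. X \<omega> \<in> A \<and> Y \<omega> \<in> B} = (\<lambda>\<omega>. (X \<omega>, Y \<omega>)) -` (A \<times> B) \<inter> space M"
    "{\<omega> \<in> space M. X \<omega> \<in> A} = X -` A \<inter> space M"
    "{\<omega> \<in> space M. Y \<omega> \<in> B} = Y -` B \<inter> space M"
    by auto
  then show ?thesis using indep_varD[OF ind, of A B] by simp
qed

text \<open>
  If \<open>Y < - e\<close> had positive probability for some \<open>e > 0\<close>, then by independence it would occur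
  together with \<open>c * X \<le> e\<close>, and the sum would be negative. The levels \<open>e = 1 / Suc n\<close> exhaust
  the event \<open>Y < 0\<close>.
\<close>
lemma (in prob_space) AE_nonneg_of_indep_sum:
  fixes X Y :: "'a \<Rightarrow> real"
  assumes ind: "indep_var borel X borel Y" and c: "0 < c"
    and near0: "\<And>e. 0 < e \<Longrightarrow> 0 < prob {\<omega> \<in> space M. X \<omega> \<le> e}"
    and sum: "AE \<omega> in M. 0 \<le> c * X \<omega> + Y \<omega>"
  shows "AE \<omega> in M. 0 \<le> Y \<omega>"
proof -
  have [measurable]: "X \<in> borel_measurable M" "Y \<in> borel_measurable M"
    using indep_var_rv1[OF ind] indep_var_rv2[OF ind] by auto
  have level: "AE \<omega> in M. - (1 / Suc n) \<le> Y \<omega>" for n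
  proof -
    define e where "e = 1 / real (Suc n)"
    have e: "0 < e" by (simp add: e_def)
    have "AE \<omega> in M. \<not> (X \<omega> \<in> {..e / c} \<and> Y \<omega> \<in> {..<- e})"
      using sum
    proof eventually_elim
      case (elim \<omega>)
      then show ?case using c by (auto simp: field_simps)
    qed
    then have "prob {\<omega> \<in> space M. X \<omega> \<in> {..e / c} \<and> Y \<omega> \<in> {..<- e}} = 0"
      by (subst prob_eq_0) auto
    then have "prob {\<omega> \<in> space M. X \<omega> \<le> e / c} * prob {\<omega> \<in> space M. Y \<omega> < - e} = 0"
      using prob_indep_conj[OF ind, of "{..e / c}" "{..<- e}"] by simp
    moreover have "0 < prob {\<omega> \<in> space M. X \<omega> \<le> e / c}"
      using e c by (intro near0) simp
    ultimately have "prob {\<omega> \<in> space M. Y \<omega> < - e} = 0" by simp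
    then have "AE \<omega> in M. \<not> Y \<omega> < - e"
      by (subst (asm) prob_eq_0) auto
    then show ?thesis unfolding e_def by (simp add: not_less)
  qed
  then have "AE \<omega> in M. \<forall>n. - (1 / Suc n) \<le> Y \<omega>"
    by (subst AE_all_countable) blast
  then show ?thesis
  proof eventually_elim
    case (elim \<omega>)
    show ?case
    proof (rule ccontr)
      assume "\<not> 0 \<le> Y \<omega>"
      then obtain n where "1 / Suc n < - Y \<omega>"
        using nat_approx_posE[of "- Y \<omega>"] by auto
      with spec[OF elim, of n] show False by linarith
    qed
  qed
qed

lemma (in prob_space) prob_indep_sum_le:
  fixes X Y :: "'a \<Rightarrow> real"
  assumes ind: "indep_var borel X borel Y" and c: "0 < c"
    and X: "AE \<omega> in M. 0 \<le> X \<omega>" and Y: "AE \<omega> in M. 0 \<le> Y \<omega>"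
  shows "prob {\<omega> \<in> space M. c * X \<omega> + Y \<omega> \<le> s} \<le>
         prob {\<omega> \<in> space M. X \<omega> \<le> s / c} * prob {\<omega> \<in> space M. Y \<omega> \<le> s}"
proof -
  have [measurable]: "X \<in> borel_measurable M" "Y \<in> borel_measurable M"
    using indep_var_rv1[OF ind] indep_var_rv2[OF ind] by auto
  have "prob {\<omega> \<in> space M. c * X \<omega> + Y \<omega> \<le> s} \<le>
        prob {\<omega> \<in> space M. X \<omega> \<in> {..s / c} \<and> Y \<omega> \<in> {..s}}"
  proof (rule finite_measure_mono_AE)
    show "AE \<omega> in M. \<omega> \<in> {\<omega> \<in> space M. c * X \<omega> + Y \<omega> \<le> s} \<longrightarrow>
        \<omega> \<in> {\<omega> \<in> space M. X \<omega> \<in> {..s / c} \<and> Y \<omega> \<in> {..s}}"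
      using X Y
    proof eventually_elim
      case (elim \<omega>)
      have "0 \<le> c * X \<omega>" using elim c by simp
      then have "c * X \<omega> \<le> s \<and> Y \<omega> \<le> s" if "c * X \<omega> + Y \<omega> \<le> s"
        using elim that by linarith
      with c show ?case by (auto simp: pos_le_divide_eq mult.commute)
    qed
  qed measurable
  also have "\<dots> = prob {\<omega> \<in> space M. X \<omega> \<le> s / c} * prob {\<omega> \<in> space M. Y \<omega> \<le> s}"
    using prob_indep_conj[OF ind, of "{..s / c}" "{..s}"] by simp
  finally show ?thesis .
qed

text \<open>
  Dividing \<open>F s \<le> F (s / c) * P(Y \<le> s)\<close> by \<open>F (s / c)\<close> squeezes \<open>P(Y \<le> s)\<close> between a quotient
  that tends to \<open>1\<close> by slow variation and \<open>1\<close> itself.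
\<close>
lemma (in prob_space) prob_remainder_nonpos:
  fixes X Y :: "'a \<Rightarrow> real" and F :: "real \<Rightarrow> real"
  assumes ind: "indep_var borel X borel Y" and c: "0 < c"
    and FX: "\<And>x. prob {\<omega> \<in> space M. X \<omega> \<le> x} = F x"
    and FS: "\<And>x. prob {\<omega> \<in> space M. c * X \<omega> + Y \<omega> \<le> x} = F x"
    and X: "AE \<omega> in M. 0 \<le> X \<omega>" and Y: "AE \<omega> in M. 0 \<le> Y \<omega>"
    and pos: "\<And>x. 0 < x \<Longrightarrow> 0 < F x"
    and slow: "((\<lambda>s. F (s / c) / F s) \<longlongrightarrow> 1) (at_right 0)"
  shows "prob {\<omega> \<in> space M. Y \<omega> \<le> 0} = 1"
proof -
  define G where "G s = prob {\<omega> \<in> space M. Y \<omega> \<le> s}" for s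
  have mY: "Y \<in> borel_measurable M" using indep_var_rv2[OF ind] by simp
  interpret D: real_distribution "distr M borel Y"
    using mY by (simp add: real_distribution_distr)
  have G: "G = cdf (distr M borel Y)"
    unfolding G_def using cdf_distr_eq_prob[OF mY] by auto
  have "(G \<longlongrightarrow> G 0) (at_right 0)"
    using D.cdf_is_right_cont[of 0] by (simp add: G continuous_within)
  moreover have "((\<lambda>s. inverse (F (s / c) / F s)) \<longlongrightarrow> 1) (at_right 0)"
    using tendsto_inverse[OF slow] by simp
  moreover have "\<forall>\<^sub>F s in at_right 0. inverse (F (s / c) / F s) \<le> G s"
    using eventually_at_right_less
  proof eventually_elim
    case (elim s)
    have "0 < F (s / c)" using elim c by (intro pos) simp
    moreover have "F s \<le> F (s / c) * G s"
      using prob_indep_sum_le[OF ind c X Y, of s] by (simp add: FX FS G_def)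
    ultimately show ?case by (simp add: field_simps)
  qed
  ultimately have "1 \<le> G 0" by (intro tendsto_le[of "at_right (0::real)"]) auto
  then show ?thesis unfolding G_def by (intro antisym) auto
qed

text \<open>
  Iterating the hypothesis pushes the argument out to infinity, where a distribution function
  tends to \<open>1\<close>.
\<close>
lemma (in real_distribution) cdf_eq_1_of_scaling:
  assumes scale: "\<And>x. 0 < x \<Longrightarrow> cdf M (x / c) \<le> cdf M x"
    and c: "0 < c" "c < 1" and s: "0 < s"
  shows "cdf M s = 1"
proof (rule antisym)
  have iter: "cdf M (s / c ^ n) \<le> cdf M s" for n
  proof (induction n)
    case (Suc n)
    have "cdf M (s / c ^ n / c) \<le> cdf M (s / c ^ n)"
      using c s by (intro scale) simp
    with Suc show ?case by (simp add: mult.commute)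
  qed simp
  have "filterlim (\<lambda>n. s * inverse c ^ n) at_top sequentially"
    using s c by (intro filterlim_tendsto_pos_mult_at_top[OF tendsto_const]
        filterlim_realpow_sequentially_gt1[THEN filterlim_at_infinity_imp_filterlim_at_top])
      (auto simp: one_less_inverse)
  then have "filterlim (\<lambda>n. s / c ^ n) at_top sequentially"
    by (simp add: power_inverse divide_inverse)
  then have "(\<lambda>n. cdf M (s / c ^ n)) \<longlonglongrightarrow> 1"
    by (rule filterlim_compose[OF cdf_lim_at_top_prob])
  then show "1 \<le> cdf M s"
    by (rule LIMSEQ_le_const2) (use iter in auto)
qed (rule cdf_bounded_prob)

theorem theorem2:
  fixes M :: "'a measure" and \<eta> :: "'a \<Rightarrow> real" and F :: "real \<Rightarrow> real"
  assumes "prob_space M"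
    and "\<eta> \<in> borel_measurable M"
    and "measure M {\<omega> \<in> space M. \<eta> \<omega> > 0} = 1"
    and "\<And>x. F x = measure M {\<omega> \<in> space M. \<eta> \<omega> \<le> x}"
    and "slowly_varying_at_0 F"
  shows "\<not> selfdecomposable F"
proof
  assume "selfdecomposable F"
  then obtain \<mu> where \<mu>: "real_distribution \<mu>" "cdf \<mu> = F" "selfdecomposable_law \<mu>"
    unfolding selfdecomposable_def by blast
  interpret D: real_distribution \<mu> by (rule \<mu>(1))
  interpret M: prob_space M by (rule assms(1))
  note [measurable] = assms(2)
  have "F 0 = M.prob (space M - {\<omega> \<in> space M. \<eta> \<omega> > 0})"
    unfolding assms(4) by (rule arg_cong[where f = M.prob]) auto
  also have "\<dots> = 0" using assms(3) by (subst M.prob_compl) auto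
  finally have F0: "F 0 = 0" .
  have mono: "F x \<le> F y" if "x \<le> y" for x y
    using D.cdf_nondecreasing[OF that] by (simp add: \<mu>(2))
  obtain \<delta> where \<delta>: "0 < \<delta>" "\<And>s. s \<in> {0<..<\<delta>} \<Longrightarrow> 0 < F s"
    and slow: "\<And>c. 0 < c \<Longrightarrow> ((\<lambda>s. F (c * s) / F s) \<longlongrightarrow> 1) (at_right 0)"
    using assms(5) unfolding slowly_varying_at_0_def by blast
  have pos: "0 < F x" if "0 < x" for x
  proof -
    have "0 < F (min x (\<delta> / 2))" using \<delta>(1) that by (intro \<delta>(2)) auto
    also have "\<dots> \<le> F x" by (rule mono) simp
    finally show ?thesis .
  qed
  \<comment> \<open>The argument is the same for every contraction factor in \<open>(0, 1)\<close>.\<close>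
  define c :: real where "c = 1 / 2"
  have c: "0 < c" "c < 1" by (auto simp: c_def)
  obtain N :: "(real \<times> real) measure" and X Y where N: "prob_space N"
    and ind: "prob_space.indep_var N borel X borel Y"
    and dX: "distr N borel X = \<mu>" and dS: "distr N borel (\<lambda>\<omega>. c * X \<omega> + Y \<omega>) = \<mu>"
    using \<mu>(3) c unfolding selfdecomposable_law_def by blast
  interpret N: prob_space N by (rule N)
  have [measurable]: "X \<in> borel_measurable N" "Y \<in> borel_measurable N"
    using N.indep_var_rv1[OF ind] N.indep_var_rv2[OF ind] by auto
  have FX: "N.prob {\<omega> \<in> space N. X \<omega> \<le> x} = F x" for x
    using cdf_distr_eq_prob[of X N x] by (simp add: dX \<mu>(2))
  have FS: "N.prob {\<omega> \<in> space N. c * X \<omega> + Y \<omega> \<le> x} = F x" for x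
    using cdf_distr_eq_prob[of "\<lambda>\<omega>. c * X \<omega> + Y \<omega>" N x] by (simp add: dS \<mu>(2))
  have AE_nonneg: "AE \<omega> in N. 0 \<le> Z \<omega>"
    if [measurable]: "Z \<in> borel_measurable N" and "N.prob {\<omega> \<in> space N. Z \<omega> \<le> 0} = F 0"
    for Z :: "real \<times> real \<Rightarrow> real"
  proof -
    have "AE \<omega> in N. \<not> Z \<omega> \<le> 0"
      using that(2) by (subst (asm) F0, subst (asm) N.prob_eq_0) auto
    then show ?thesis by eventually_elim simp
  qed
  have X: "AE \<omega> in N. 0 \<le> X \<omega>"
    by (rule AE_nonneg) (simp_all add: FX)
  have "AE \<omega> in N. 0 \<le> c * X \<omega> + Y \<omega>"
    by (rule AE_nonneg) (simp_all add: FS)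
  then have Y: "AE \<omega> in N. 0 \<le> Y \<omega>"
    using N.AE_nonneg_of_indep_sum[OF ind c(1)] by (simp add: FX pos)
  have "((\<lambda>s. F (s / c) / F s) \<longlongrightarrow> 1) (at_right 0)"
    using slow[of "1 / c"] c by simp
  then have "N.prob {\<omega> \<in> space N. Y \<omega> \<le> 0} = 1"
    using N.prob_remainder_nonpos[OF ind c(1) FX FS X Y pos] by simp
  then have Y0: "AE \<omega> in N. Y \<omega> \<le> 0"
    by (subst (asm) N.prob_eq_1) auto
  have "F (x / c) \<le> F x" for x
    unfolding FX[symmetric, of "x / c"] FS[symmetric, of x]
  proof (rule N.finite_measure_mono_AE)
    show "AE \<omega> in N. \<omega> \<in> {\<omega> \<in> space N. X \<omega> \<le> x / c} \<longrightarrow>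
        \<omega> \<in> {\<omega> \<in> space N. c * X \<omega> + Y \<omega> \<le> x}"
      using Y0
    proof eventually_elim
      case (elim \<omega>)
      then show ?case using c by (auto simp: field_simps)
    qed
  qed measurable
  then have F1: "F s = 1" if "0 < s" for s
    using D.cdf_eq_1_of_scaling[OF _ c that] by (simp add: \<mu>(2))
  have "(F \<longlongrightarrow> F 0) (at_right 0)"
    using D.cdf_is_right_cont[of 0] by (simp add: \<mu>(2) continuous_within)
  moreover have "(F \<longlongrightarrow> 1) (at_right 0)"
    by (rule tendsto_eventually) (use eventually_at_right_less in eventually_elim, rule F1)
  ultimately have "F 0 = 1"
    by (intro tendsto_unique[of "at_right (0::real)"]) auto
  with F0 show False by simp
qed

end
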